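(* Two split quaternions $a,b\in\mathbb{H}_s\setminus\mathbb{R}$ are similar if and only if $\Re(a)=\Re(b)$ and $K(a)=K(b)$.
   Context: $\mathbb{H}_s=\{q_0+q_1\mathbf{i}+q_2\mathbf{j}+q_3\mathbf{k}: q_i\in\mathbb{R}\}$ is the real associative algebra of split quaternions with $\mathbf{i}^2=-1$, $\mathbf{j}^2=\mathbf{k}^2=1$, $\mathbf{i}\mathbf{j}=\mathbf{k}=-\mathbf{j}\mathbf{i}$, $\mathbf{j}\mathbf{k}=-\mathbf{i}=-\mathbf{k}\mathbf{j}$, $\mathbf{k}\mathbf{i}=\mathbf{j}=-\mathbf{i}\mathbf{k}$. For $q=q_0+q_1\mathbf{i}+q_2\mathbf{j}+q_3\mathbf{k}$: $\Re(q)=q_0$, $K(q)=-q_1^2+q_2^2+q_3^2$, $I_q=q_0^2+q_1^2-q_2^2-q_3^2$, and $Z(\mathbb{H}_s)=\{q\in\mathbb{H}_s:I_q=0\}$. Two split quaternions $a,b$ are similar if there exists $q\in\mathbb{H}_s\setminus Z(\mathbb{H}_s)$ such that $qa=bq$. *)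

theory Defs
  imports Complex_Main
begin

(* Squat q0 q1 q2 q3 stands for q0 + q1 i + q2 j + q3 k; see squat_expansion and squat_table. *)
datatype squat = Squat (sq_Re: real) (sq_Im1: real) (sq_Im2: real) (sq_Im3: real)

lemma squat_eq_iff:
  "p = q \<longleftrightarrow> sq_Re p = sq_Re q \<and> sq_Im1 p = sq_Im1 q \<and> sq_Im2 p = sq_Im2 q \<and> sq_Im3 p = sq_Im3 q"
  by (auto intro: squat.expand)

instantiation squat :: real_algebra_1
begin

definition zero_squat :: squat where
  "0 = Squat 0 0 0 0"

definition one_squat :: squat where
  "1 = Squat 1 0 0 0"

definition plus_squat :: "squat \<Rightarrow> squat \<Rightarrow> squat" where
  "p + q = Squat (sq_Re p + sq_Re q) (sq_Im1 p + sq_Im1 q) (sq_Im2 p + sq_Im2 q) (sq_Im3 p + sq_Im3 q)"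

definition uminus_squat :: "squat \<Rightarrow> squat" where
  "- q = Squat (- sq_Re q) (- sq_Im1 q) (- sq_Im2 q) (- sq_Im3 q)"

definition minus_squat :: "squat \<Rightarrow> squat \<Rightarrow> squat" where
  "p - q = Squat (sq_Re p - sq_Re q) (sq_Im1 p - sq_Im1 q) (sq_Im2 p - sq_Im2 q) (sq_Im3 p - sq_Im3 q)"

definition scaleR_squat :: "real \<Rightarrow> squat \<Rightarrow> squat" where
  "r *\<^sub>R q = Squat (r * sq_Re q) (r * sq_Im1 q) (r * sq_Im2 q) (r * sq_Im3 q)"

(* The bilinear extension of i^2 = -1, j^2 = k^2 = 1, ij = k = -ji, jk = -i = -kj, ki = j = -ik. *)
definition times_squat :: "squat \<Rightarrow> squat \<Rightarrow> squat" where
  "p * q = Squat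
    (sq_Re p * sq_Re q - sq_Im1 p * sq_Im1 q + sq_Im2 p * sq_Im2 q + sq_Im3 p * sq_Im3 q)
    (sq_Re p * sq_Im1 q + sq_Im1 p * sq_Re q - sq_Im2 p * sq_Im3 q + sq_Im3 p * sq_Im2 q)
    (sq_Re p * sq_Im2 q + sq_Im2 p * sq_Re q + sq_Im3 p * sq_Im1 q - sq_Im1 p * sq_Im3 q)
    (sq_Re p * sq_Im3 q + sq_Im3 p * sq_Re q + sq_Im1 p * sq_Im2 q - sq_Im2 p * sq_Im1 q)"

instance
  by standard
    (simp_all add: squat_eq_iff zero_squat_def one_squat_def plus_squat_def uminus_squat_def
      minus_squat_def scaleR_squat_def times_squat_def algebra_simps)

end

lemmas squat_ops = zero_squat_def one_squat_def plus_squat_def uminus_squat_def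
  minus_squat_def scaleR_squat_def times_squat_def

definition sq_i :: squat where "sq_i = Squat 0 1 0 0"
definition sq_j :: squat where "sq_j = Squat 0 0 1 0"
definition sq_k :: squat where "sq_k = Squat 0 0 0 1"

lemma squat_of_real: "of_real r = Squat r 0 0 0"
  by (simp add: of_real_def squat_ops)

lemma squat_expansion:
  "Squat q0 q1 q2 q3 = of_real q0 + of_real q1 * sq_i + of_real q2 * sq_j + of_real q3 * sq_k"
  by (simp add: squat_of_real squat_ops sq_i_def sq_j_def sq_k_def)

lemma squat_table:
  "sq_i * sq_i = - 1" "sq_j * sq_j = 1" "sq_k * sq_k = 1"
  "sq_i * sq_j = sq_k" "sq_j * sq_i = - sq_k"
  "sq_j * sq_k = - sq_i" "sq_k * sq_j = sq_i"
  "sq_k * sq_i = sq_j" "sq_i * sq_k = - sq_j"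
  by (simp_all add: squat_ops sq_i_def sq_j_def sq_k_def)

definition sq_K :: "squat \<Rightarrow> real" where
  "sq_K q = - (sq_Im1 q)\<^sup>2 + (sq_Im2 q)\<^sup>2 + (sq_Im3 q)\<^sup>2"

definition sq_I :: "squat \<Rightarrow> real" where
  "sq_I q = (sq_Re q)\<^sup>2 + (sq_Im1 q)\<^sup>2 - (sq_Im2 q)\<^sup>2 - (sq_Im3 q)\<^sup>2"

definition sq_Z :: "squat set" where
  "sq_Z = {q. sq_I q = 0}"

definition sq_similar :: "squat \<Rightarrow> squat \<Rightarrow> bool" where
  "sq_similar a b \<longleftrightarrow> (\<exists>q. q \<in> UNIV - sq_Z \<and> q * a = b * q)"

end

theory Submission
  imports Defs
begin

text \<open>
  The quantity \<open>sq_I\<close> is a multiplicative quadratic form, the norm of the algebra.  If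
  \<open>q * a = b * q\<close>, then \<open>q * (a + 1) = (b + 1) * q\<close> too, so when \<open>sq_I q \<noteq> 0\<close> the norms of
  \<open>a\<close>, \<open>b\<close> and of \<open>a + 1\<close>, \<open>b + 1\<close> agree.  The norm of \<open>a + 1\<close> exceeds that of \<open>a\<close> by
  \<open>2 * sq_Re a + 1\<close>, so the real parts agree, and then so does \<open>sq_K = sq_Re\<^sup>2 - sq_I\<close>.

  Conversely, subtracting the common real part reduces the problem to nonzero elements \<open>u\<close>, \<open>v\<close>
  with zero real part and \<open>sq_K u = sq_K v\<close>.  Their squares are then the same real number, so
  \<open>v * x + x * u\<close> intertwines \<open>u\<close> and \<open>v\<close> for every \<open>x\<close> (lemma \<open>intertwiner\<close>).  It remains to choose
  \<open>x\<close> so that this element has nonzero norm, and one of the four basis elements always works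
  (lemma \<open>intertwiner_nonsingular\<close>): the only way all four norms can vanish is that
  \<open>sq_K u = 0\<close> and all products of corresponding coordinates of \<open>u\<close> and \<open>v\<close> are zero, which is
  impossible because \<open>sq_K u = sq_K v = 0\<close> forces nonzero \<open>u\<close> and \<open>v\<close> to have nonzero
  \<open>\<i>\<close>-coordinates.
\<close>

lemma sq_I_mult: "sq_I (p * q) = sq_I p * sq_I q"
  by (simp add: sq_I_def squat_ops power2_eq_square algebra_simps)

lemma sq_I_add_one: "sq_I (q + 1) = sq_I q + 2 * sq_Re q + 1"
  by (simp add: sq_I_def squat_ops power2_eq_square algebra_simps)

lemma sq_K_eq_Re_I: "sq_K q = (sq_Re q)\<^sup>2 - sq_I q"
  by (simp add: sq_K_def sq_I_def)

lemma sq_I_eq_if_intertwined: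
  assumes "sq_I q \<noteq> 0" and "q * a = b * q"
  shows "sq_I a = sq_I b"
  using assms(1) arg_cong[OF assms(2), of sq_I] by (simp add: sq_I_mult)

lemma square_of_pure:
  assumes "sq_Re u = 0"
  shows "u * u = of_real (sq_K u)"
  using assms by (simp add: squat_of_real squat_ops sq_K_def power2_eq_square)

text \<open>
  Multiplying \<open>v * x + x * u\<close> by \<open>u\<close> on the right or by \<open>v\<close> on the left gives the same two terms,
  \<open>v * x * u\<close> and the multiple of \<open>x\<close> by the common square, because that square is central.
\<close>

lemma intertwiner:
  fixes u v x :: "'a::real_algebra_1"
  assumes "u * u = of_real c" and "v * v = of_real c"
  shows "(v * x + x * u) * u = v * (v * x + x * u)"
proof -
  have "(v * x + x * u) * u = v * x * u + x * (u * u)"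
    by (simp add: distrib_right mult.assoc)
  also have "x * (u * u) = (v * v) * x"
    using assms by (simp add: of_real_def)
  finally show ?thesis
    by (simp add: distrib_left mult.assoc)
qed

text \<open>
  For \<open>u\<close>, \<open>v\<close> with the same value \<open>K\<close> of \<open>sq_K\<close>, the norms for \<open>x\<close> among \<open>1, \<i>, \<j>, \<k>\<close> are, up to
  the factor \<open>\<plusminus>2\<close>, the four combinations of \<open>K\<close> with the products \<open>u\<^sub>n * v\<^sub>n\<close> of corresponding
  coordinates in which the signs form an invertible matrix.  If all four vanish, then \<open>K = 0\<close> and
  \<open>u\<^sub>1 * v\<^sub>1 = 0\<close>; a vanishing \<open>\<i>\<close>-coordinate makes \<open>K\<close> the sum of the squares of the other two,
  so \<open>u\<close> or \<open>v\<close> would be zero.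
\<close>

lemma intertwiner_nonsingular:
  assumes "sq_Re u = 0" and "sq_Re v = 0" and K: "sq_K u = sq_K v" and "u \<noteq> 0" and "v \<noteq> 0"
  obtains x where "sq_I (v * x + x * u) \<noteq> 0"
proof (rule ccontr)
  assume "\<not> thesis"
  with that have null: "sq_I (v * x + x * u) = 0" for x
    by blast
  obtain u1 u2 u3 where u: "u = Squat 0 u1 u2 u3"
    using assms(1) by (cases u) simp
  obtain v1 v2 v3 where v: "v = Squat 0 v1 v2 v3"
    using assms(2) by (cases v) simp
  define k where "k = sq_K u"
  have ku: "u2 * u2 + u3 * u3 = k + u1 * u1"
    by (simp add: k_def u sq_K_def power2_eq_square)
  have kv: "v2 * v2 + v3 * v3 = k + v1 * v1"
    unfolding k_def K by (simp add: v sq_K_def power2_eq_square)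
  have one: "k - u1 * v1 + u2 * v2 + u3 * v3 = 0"
    using null[of 1] ku kv
    by (simp add: u v sq_I_def squat_ops power2_eq_square algebra_simps)
  have i: "k - u1 * v1 - u2 * v2 - u3 * v3 = 0"
    using null[of sq_i] ku kv
    by (simp add: u v sq_i_def sq_I_def squat_ops power2_eq_square algebra_simps)
  have j: "k + u1 * v1 + u2 * v2 - u3 * v3 = 0"
    using null[of sq_j] ku kv
    by (simp add: u v sq_j_def sq_I_def squat_ops power2_eq_square algebra_simps)
  have k: "k + u1 * v1 - u2 * v2 + u3 * v3 = 0"
    using null[of sq_k] ku kv
    by (simp add: u v sq_k_def sq_I_def squat_ops power2_eq_square algebra_simps)
  have "k = 0" and "u1 * v1 = 0"
    using one i j k by linarith+
  then consider "u1 = 0" | "v1 = 0"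
    by auto
  then show False
  proof cases
    case 1
    then have "u = 0"
      using ku \<open>k = 0\<close> by (simp add: u zero_squat_def sum_squares_eq_zero_iff)
    with \<open>u \<noteq> 0\<close> show False ..
  next
    case 2
    then have "v = 0"
      using kv \<open>k = 0\<close> by (simp add: v zero_squat_def sum_squares_eq_zero_iff)
    with \<open>v \<noteq> 0\<close> show False ..
  qed
qed

theorem theorem4p3:
  fixes a b :: squat
  assumes "a \<in> UNIV - \<real>" and "b \<in> UNIV - \<real>"
  shows "sq_similar a b \<longleftrightarrow> sq_Re a = sq_Re b \<and> sq_K a = sq_K b"
proof
  assume "sq_similar a b"
  then obtain q where q: "sq_I q \<noteq> 0" "q * a = b * q"
    by (auto simp: sq_similar_def sq_Z_def)
  have "q * (a + 1) = (b + 1) * q"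
    using q(2) by (simp add: distrib_left distrib_right)
  with q have "sq_I a = sq_I b" and "sq_I (a + 1) = sq_I (b + 1)"
    by (blast intro: sq_I_eq_if_intertwined)+
  then show "sq_Re a = sq_Re b \<and> sq_K a = sq_K b"
    by (simp add: sq_I_add_one sq_K_eq_Re_I)
next
  assume eq: "sq_Re a = sq_Re b \<and> sq_K a = sq_K b"
  define r :: squat where "r = of_real (sq_Re a)"
  define u where "u = a - r"
  define v where "v = b - r"
  have pure: "sq_Re u = 0" "sq_Re v = 0"
    using eq by (simp_all add: u_def v_def r_def squat_of_real minus_squat_def)
  have K: "sq_K u = sq_K v"
    using eq by (simp add: u_def v_def r_def squat_of_real minus_squat_def sq_K_def)
  have "r \<in> \<real>"
    by (simp add: r_def)
  then have "a \<noteq> r" and "b \<noteq> r"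
    using assms by blast+
  then have "u \<noteq> 0" and "v \<noteq> 0"
    by (simp_all add: u_def v_def)
  then obtain x where x: "sq_I (v * x + x * u) \<noteq> 0"
    using intertwiner_nonsingular pure K by blast
  define q where "q = v * x + x * u"
  have "q * u = v * q"
    unfolding q_def
  proof (rule intertwiner)
    show "u * u = of_real (sq_K v)"
      using square_of_pure[OF pure(1)] by (simp add: K)
    show "v * v = of_real (sq_K v)"
      by (rule square_of_pure[OF pure(2)])
  qed
  moreover have "q * r = r * q"
    by (simp add: r_def of_real_def)
  ultimately have "q * a = b * q"
    by (simp add: u_def v_def algebra_simps)
  with x show "sq_similar a b"
    by (auto simp: sq_similar_def sq_Z_def q_def)
qed

end
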